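(* Let $q$ be a prime power, $e\in\{0,1,2\}$, and $r$ an integer with $r$ odd if $e\in\{0,2\}$ and $r$ even if $e=1$. If there exists a hyperbolic ($e=0$), parabolic ($e=1$) or elliptic ($e=2$) affine vector space partition of ${\rm PG}(r+1,q)$, then the non-degenerate quadric $\mathcal Q_{r+2,e}$ of ${\rm PG}(r+2,q)$ (i.e. $\mathcal Q^+(r+2,q)$, $\mathcal Q(r+2,q)$, $\mathcal Q^-(r+2,q)$ respectively) admits a spread.
   Context: Notation: $\mathcal Q_{m,e}$ denotes a non-degenerate quadric of ${\rm PG}(m,q)$ which is hyperbolic $\mathcal Q^+(m,q)$ if $e=0$ ($m$ odd), parabolic $\mathcal Q(m,q)$ if $e=1$ ($m$ even), elliptic $\mathcal Q^-(m,q)$ if $e=2$ ($m$ odd). A generator of $\mathcal Q_{m,e}$ is a projective subspace of maximal dimension contained in it; generators are $\frac{m-e-1}{2}$-dimensional. A spread of $\mathcal Q_{m,e}$ is a set of $q^{\frac{m+e-1}{2}}+1$ pairwise disjoint generators (equivalently, a set of generators partitioning the points of the quadric). An $s$-space means an $s$-dimensional projective subspace. Affine vector space partition (avsp): given a hyperplane $H$ of ${\rm PG}(r+1,q)$, an avsp of ${\rm PG}(r+1,q)$ (with respect to $H$) is a set $\mathcal P$ of subspaces of ${\rm PG}(r+1,q)$, none contained in $H$, such that every point of ${\rm PG}(r+1,q)\setminus H$ lies in exactly one member of $\mathcal P$. Hyperbolic/parabolic/elliptic avsp: with $e=0,1,2$ respectively, an avsp $\mathcal P=\{S_1,\dots,S_N\}$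 of ${\rm PG}(r+1,q)$ with respect to a hyperplane $H$, where $N=q^{\frac{r+e+1}{2}}$ and every $S_i$ is a $\frac{r-e+1}{2}$-space, is called hyperbolic, parabolic or elliptic if the sets $\Pi_i=S_i\cap H$ ($i=1,\dots,N$) are $N$ generators of a non-degenerate quadric $\mathcal Q_{r,e}\subset H$ such that: (1) each $\Pi_i$ is disjoint from a fixed generator $\Pi$ of $\mathcal Q_{r,e}$; (2) distinct $S_i,S_j$ meet in at most one point, and distinct $\Pi_i,\Pi_j$ meet in at most one point; (3) if $|\Pi_i\cap\Pi_j|=1$, then $\langle S_i,S_j\rangle\cap\mathcal Q_{r,e}$ is a non-degenerate hyperbolic quadric $\mathcal Q^+(r-e,q)$. *)

theory Defs
  imports Main
begin

text \<open>
  Model of PG(n,q): the vector space F^(n+1) over a finite field F (the type 'a,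
  with q = card (UNIV :: 'a set)), represented as functions nat => 'a vanishing from index n+1 on.
  A projective s-space is a linear subspace of vector dimension s+1; since F is finite,
  a linear subspace W has vector dimension k iff card W = q^k.
  All dimensions below are VECTOR dimensions (projective dimension + 1).
\<close>

definition vecs :: "nat \<Rightarrow> (nat \<Rightarrow> 'a::field) set" where
  "vecs N = {v. \<forall>i\<ge>N. v i = 0}"

definition is_lsub :: "(nat \<Rightarrow> 'a::field) set \<Rightarrow> (nat \<Rightarrow> 'a) set \<Rightarrow> bool" where
  "is_lsub V W \<longleftrightarrow> W \<subseteq> V \<and> (\<lambda>i. 0) \<in> W \<and>
     (\<forall>u\<in>W. \<forall>w\<in>W. (\<lambda>i. u i + w i) \<in> W) \<and>
     (\<forall>c. \<forall>w\<in>W. (\<lambda>i. c * w i) \<in> W)"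

definition is_sub :: "nat \<Rightarrow> (nat \<Rightarrow> 'a::{field,finite}) set \<Rightarrow> nat \<Rightarrow> bool" where
  "is_sub N W k \<longleftrightarrow> is_lsub (vecs N) W \<and> card W = card (UNIV :: 'a set) ^ k"

definition lspan :: "nat \<Rightarrow> (nat \<Rightarrow> 'a::field) set \<Rightarrow> (nat \<Rightarrow> 'a) set" where
  "lspan N A = \<Inter>{W. is_lsub (vecs N) W \<and> A \<subseteq> W}"

definition quad_form :: "nat \<Rightarrow> ((nat \<Rightarrow> 'a::field) \<Rightarrow> 'a) \<Rightarrow> bool" where
  "quad_form N Q \<longleftrightarrow> (\<exists>c :: nat \<Rightarrow> nat \<Rightarrow> 'a.
      \<forall>v. Q v = (\<Sum>i<N. \<Sum>j\<in>{i..<N}. c i j * v i * v j))"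

definition polar :: "((nat \<Rightarrow> 'a::field) \<Rightarrow> 'a) \<Rightarrow> (nat \<Rightarrow> 'a) \<Rightarrow> (nat \<Rightarrow> 'a) \<Rightarrow> 'a" where
  "polar Q u v = Q (\<lambda>i. u i + v i) - Q u - Q v"

definition nonsingular_on :: "((nat \<Rightarrow> 'a::field) \<Rightarrow> 'a) \<Rightarrow> (nat \<Rightarrow> 'a) set \<Rightarrow> bool" where
  "nonsingular_on Q W \<longleftrightarrow>
     (\<forall>w\<in>W. Q w = 0 \<and> (\<forall>u\<in>W. polar Q w u = 0) \<longrightarrow> w = (\<lambda>i. 0))"

definition tsing :: "nat \<Rightarrow> ((nat \<Rightarrow> 'a::{field,finite}) \<Rightarrow> 'a) \<Rightarrow> (nat \<Rightarrow> 'a) set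
                     \<Rightarrow> (nat \<Rightarrow> 'a) set \<Rightarrow> nat \<Rightarrow> bool" where
  "tsing N Q W G k \<longleftrightarrow> is_sub N G k \<and> G \<subseteq> W \<and> (\<forall>v\<in>G. Q v = 0)"

text \<open>The quadric of the form Q in the subspace W (vector dimension n, i.e. projective
  dimension m = n-1) is a non-degenerate quadric Q_{m,e}: Q is non-singular on W and its
  generators (maximal totally singular subspaces) have projective dimension (m-e-1)/2,
  i.e. vector dimension (n-e)/2.\<close>
definition nondeg_quadric :: "nat \<Rightarrow> ((nat \<Rightarrow> 'a::{field,finite}) \<Rightarrow> 'a) \<Rightarrow> (nat \<Rightarrow> 'a) set
                              \<Rightarrow> nat \<Rightarrow> nat \<Rightarrow> bool" where
  "nondeg_quadric N Q W n e \<longleftrightarrow> is_sub N W n \<and> nonsingular_on Q W \<and>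
     (\<exists>G. tsing N Q W G ((n - e) div 2)) \<and> \<not> (\<exists>G. tsing N Q W G ((n - e) div 2 + 1))"

definition generator :: "nat \<Rightarrow> ((nat \<Rightarrow> 'a::{field,finite}) \<Rightarrow> 'a) \<Rightarrow> (nat \<Rightarrow> 'a) set
                         \<Rightarrow> nat \<Rightarrow> nat \<Rightarrow> (nat \<Rightarrow> 'a) set \<Rightarrow> bool" where
  "generator N Q W n e G \<longleftrightarrow> tsing N Q W G ((n - e) div 2)"

definition is_spread :: "nat \<Rightarrow> ((nat \<Rightarrow> 'a::{field,finite}) \<Rightarrow> 'a) \<Rightarrow> (nat \<Rightarrow> 'a) set
                         \<Rightarrow> nat \<Rightarrow> nat \<Rightarrow> (nat \<Rightarrow> 'a) set set \<Rightarrow> bool" where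
  "is_spread N Q W n e \<Sigma> \<longleftrightarrow> (\<forall>G\<in>\<Sigma>. generator N Q W n e G) \<and>
     card \<Sigma> = card (UNIV :: 'a set) ^ ((n + e - 2) div 2) + 1 \<and>
     (\<forall>G\<in>\<Sigma>. \<forall>G'\<in>\<Sigma>. G \<noteq> G' \<longrightarrow> G \<inter> G' = {\<lambda>i. 0})"

definition special_avsp :: "nat \<Rightarrow> nat \<Rightarrow> (nat \<Rightarrow> 'a::{field,finite}) set
                            \<Rightarrow> ((nat \<Rightarrow> 'a) \<Rightarrow> 'a) \<Rightarrow> (nat \<Rightarrow> 'a) set
                            \<Rightarrow> (nat \<Rightarrow> 'a) set set \<Rightarrow> bool" where
  "special_avsp r e H Q Pi P \<longleftrightarrow>
     is_sub (r + 2) H (r + 1) \<and>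
     quad_form (r + 2) Q \<and> nondeg_quadric (r + 2) Q H (r + 1) e \<and>
     generator (r + 2) Q H (r + 1) e Pi \<and>
     \<comment> \<open>avsp: N = q^((r+e+1)/2) subspaces of projective dimension (r-e+1)/2, none in H,
         partitioning the points outside H\<close>
     card P = card (UNIV :: 'a set) ^ ((r + e + 1) div 2) \<and>
     (\<forall>S\<in>P. is_sub (r + 2) S ((r + 3 - e) div 2) \<and> \<not> S \<subseteq> H) \<and>
     (\<forall>X. is_sub (r + 2) X 1 \<and> \<not> X \<subseteq> H \<longrightarrow> (\<exists>!S. S \<in> P \<and> X \<subseteq> S)) \<and>
     \<comment> \<open>the Pi_i = S_i cap H are generators of the quadric\<close>
     (\<forall>S\<in>P. generator (r + 2) Q H (r + 1) e (S \<inter> H)) \<and>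
     \<comment> \<open>(1)\<close>
     (\<forall>S\<in>P. S \<inter> H \<inter> Pi = {\<lambda>i. 0}) \<and>
     \<comment> \<open>(2)\<close>
     (\<forall>S\<in>P. \<forall>S'\<in>P. S \<noteq> S' \<longrightarrow>
        card (S \<inter> S') \<le> card (UNIV :: 'a set) \<and> card (S \<inter> H \<inter> (S' \<inter> H)) \<le> card (UNIV :: 'a set)) \<and>
     \<comment> \<open>(3)\<close>
     (\<forall>S\<in>P. \<forall>S'\<in>P. S \<noteq> S' \<and> card (S \<inter> H \<inter> (S' \<inter> H)) = card (UNIV :: 'a set) \<longrightarrow>
        nondeg_quadric (r + 2) Q (lspan (r + 2) (S \<union> S') \<inter> H) (r + 1 - e) 0)"

end

theory Submission
  imports Defs HOL.Vector_Spaces "HOL-Library.Function_Algebras"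
begin

text \<open>
  Witt decomposition over a finite field shows that any two non-degenerate quadrics of the same type
  are similar: splitting off hyperbolic planes leaves anisotropic parts of dimension
  \<open>e \<le> 2\<close>, and these are unique up to similarity. Hence the form on \<open>F^(r+3)\<close> may be written
  as \<open>a b + c Q(h)\<close> with \<open>h \<in> H\<close>, where \<open>Q\<close> is the form of the partition.
  Projection from the \<open>a\<close>-axis, a singular point, identifies the singular points with \<open>b \<noteq> 0\<close>
  with the points outside \<open>H\<close>: the affine point \<open>h\<close> is the image of \<open>(- c Q(h), 1, h)\<close>.
  Under this map each \<open>S \<in> P\<close> is the image of a generator, because \<open>Q\<close> is affine on the affine part
  of \<open>S\<close>. Two such generators can meet only in \<open>b = 0\<close>, over a vector \<open>v\<close> of
  \<open>S \<inter> S' \<inter> H\<close>, and then \<open>v\<close> is a singular vector orthogonal to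
  \<open>\<langle>S, S'\<rangle> \<inter> H\<close>, contradicting condition (3). The generator spanned by the
  \<open>a\<close>-axis and \<open>Pi\<close> completes the spread.
\<close>

section \<open>Linear algebra in the coordinate space, with dimensions read off
  cardinalities\<close>

definition smul :: "'a::field \<Rightarrow> (nat \<Rightarrow> 'a) \<Rightarrow> nat \<Rightarrow> 'a" (infixr "*s" 75) where
  "c *s v = (\<lambda>i. c * v i)"

interpretation fv: vector_space "smul :: 'a::field \<Rightarrow> (nat \<Rightarrow> 'a) \<Rightarrow> nat \<Rightarrow> 'a"
  by unfold_locales (auto simp: smul_def fun_eq_iff algebra_simps)

lemmas smul_distribs = fv.scale_right_distrib fv.scale_left_distrib
  fv.scale_right_diff_distrib fv.scale_left_diff_distrib

text \<open>Turns the lambda terms of the given definitions into \<open>0\<close>, \<open>+\<close>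
  and \<open>*s\<close>, so that the vector-space laws apply to them.\<close>

lemma fun_ops_eq:
  "(\<lambda>i. 0) = (0 :: nat \<Rightarrow> 'a::field)"
  "(\<lambda>i. u i + w i) = (u + w :: nat \<Rightarrow> 'a)"
  "(\<lambda>i. c * w i) = (c *s w :: nat \<Rightarrow> 'a)"
  by (auto simp: smul_def fun_eq_iff)

lemma is_lsub_iff:
  "is_lsub V W \<longleftrightarrow> W \<subseteq> V \<and> 0 \<in> W \<and> (\<forall>u\<in>W. \<forall>w\<in>W. u + w \<in> W) \<and> (\<forall>c. \<forall>w\<in>W. c *s w \<in> W)"
  unfolding is_lsub_def fun_ops_eq ..

lemma lsub_zero: "is_lsub V W \<Longrightarrow> 0 \<in> W"
  and lsub_add: "is_lsub V W \<Longrightarrow> u \<in> W \<Longrightarrow> w \<in> W \<Longrightarrow> u + w \<in> W"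
  and lsub_smul: "is_lsub V W \<Longrightarrow> w \<in> W \<Longrightarrow> c *s w \<in> W"
  and lsub_subset: "is_lsub V W \<Longrightarrow> W \<subseteq> V"
  by (auto simp: is_lsub_iff)

lemma lsub_diff: "is_lsub V W \<Longrightarrow> u \<in> W \<Longrightarrow> w \<in> W \<Longrightarrow> u - w \<in> W"
  using lsub_add[of V W u "(-1) *s w"] lsub_smul[of V W w "-1"] by simp

lemmas lsub_closed = lsub_zero lsub_add lsub_smul lsub_diff

lemma lsub_vecs: "is_lsub (vecs N) (vecs N)"
  by (auto simp: is_lsub_iff vecs_def smul_def)

lemma card_field_ge_2: "card (UNIV :: 'a::{field,finite} set) \<ge> 2"
  using card_mono[of "UNIV :: 'a set" "{0, 1}"] by simp

lemma is_sub_finite: "is_sub N W k \<Longrightarrow> finite W"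
  using card_field_ge_2[where 'a='a] by (intro card_ge_0_finite) (auto simp: is_sub_def)

lemma is_sub_nontrivial:
  fixes W :: "(nat \<Rightarrow> 'a::{field,finite}) set"
  assumes "is_sub N W (Suc k)"
  obtains w where "w \<in> W" "w \<noteq> 0"
proof -
  have "card W \<noteq> card {0 :: nat \<Rightarrow> 'a}"
    using assms card_field_ge_2[where 'a='a] by (auto simp: is_sub_def)
  then have "W \<noteq> {0}" by metis
  with assms show thesis
    using that lsub_zero[of "vecs N" W] by (auto simp: is_sub_def)
qed

text \<open>The span of \<open>x\<close> and a subspace \<open>G\<close>. Dimension is encoded by
  cardinality, and as an image of pairs the span is easy to count: for \<open>x\<close> outside
  \<open>G\<close> its size is q times that of \<open>G\<close>.\<close>

definition line_plus :: "(nat \<Rightarrow> 'a::field) \<Rightarrow> (nat \<Rightarrow> 'a) set \<Rightarrow> (nat \<Rightarrow> 'a) set" where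
  "line_plus x G = (\<lambda>(a, g). a *s x + g) ` (UNIV \<times> G)"

lemma line_plus_iff: "w \<in> line_plus x G \<longleftrightarrow> (\<exists>a. \<exists>g\<in>G. w = a *s x + g)"
  by (auto simp: line_plus_def)

lemma line_plus_unique:
  assumes G: "is_lsub V G" and x: "x \<notin> G" and gh: "g \<in> G" "h \<in> G"
    and eq: "a *s x + g = b *s x + h"
  shows "a = b \<and> g = h"
proof -
  have *: "(a - b) *s x = h - g"
    using eq by (simp add: smul_distribs algebra_simps)
  have "a = b"
  proof (rule ccontr)
    assume "a \<noteq> b"
    then have "x = inverse (a - b) *s ((a - b) *s x)" by simp
    also have "\<dots> \<in> G" unfolding * by (intro lsub_closed[OF G] gh)
    finally show False using x by simp
  qed
  with eq show ?thesis by simp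
qed

lemma is_lsub_line_plus:
  assumes G: "is_lsub V G" and V: "is_lsub V V" and x: "x \<in> V"
  shows "is_lsub V (line_plus x G)"
  unfolding is_lsub_iff
proof (intro conjI ballI allI subsetI)
  fix u assume "u \<in> line_plus x G"
  then show "u \<in> V"
    using lsub_closed[OF V] x lsub_subset[OF G] by (auto simp: line_plus_iff)
next
  show "0 \<in> line_plus x G"
    unfolding line_plus_iff by (rule exI[of _ 0], rule bexI[of _ 0]) (auto intro: lsub_closed[OF G])
next
  fix u w assume "u \<in> line_plus x G" "w \<in> line_plus x G"
  then obtain a g b h where "g \<in> G" "h \<in> G" "u = a *s x + g" "w = b *s x + h"
    by (auto simp: line_plus_iff)
  then show "u + w \<in> line_plus x G"
    unfolding line_plus_iff
    by (intro exI[of _ "a + b"] bexI[of _ "g + h"]) (auto intro: lsub_closed[OF G] simp: smul_distribs)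
next
  fix c w assume "w \<in> line_plus x G"
  then obtain b h where "h \<in> G" "w = b *s x + h"
    by (auto simp: line_plus_iff)
  then show "c *s w \<in> line_plus x G"
    unfolding line_plus_iff
    by (intro exI[of _ "c * b"] bexI[of _ "c *s h"]) (auto intro: lsub_closed[OF G] simp: smul_distribs)
qed

lemma card_line_plus:
  fixes G :: "(nat \<Rightarrow> 'a::{field,finite}) set"
  assumes G: "is_lsub V G" and x: "x \<notin> G"
  shows "card (line_plus x G) = card (UNIV :: 'a set) * card G"
proof -
  have "inj_on (\<lambda>(a, g). a *s x + g) (UNIV \<times> G)"
    by (auto simp: inj_on_def dest: line_plus_unique[OF G x])
  then show ?thesis
    unfolding line_plus_def by (subst card_image) (auto simp: card_cartesian_product)
qed

lemma is_sub_line_plus: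
  assumes "is_sub N G k" "x \<in> vecs N" "x \<notin> G"
  shows "is_sub N (line_plus x G) (Suc k)"
proof -
  have G: "is_lsub (vecs N) G" using assms(1) by (simp add: is_sub_def)
  show ?thesis
    using assms(1) is_lsub_line_plus[OF G lsub_vecs assms(2)] card_line_plus[OF G assms(3)]
    by (simp add: is_sub_def)
qed

text \<open>Cancels one factor q. Orthogonal complements get their dimension this way, after the
  whole space has been rebuilt from them with \<open>line_plus\<close>.\<close>

lemma is_sub_line_plus_D:
  fixes G :: "(nat \<Rightarrow> 'a::{field,finite}) set"
  assumes "is_sub N (line_plus x G) (Suc k)" "is_lsub (vecs N) G" "x \<notin> G"
  shows "is_sub N G k"
  using assms card_field_ge_2[where 'a='a] card_line_plus[OF assms(2,3)]
  by (auto simp: is_sub_def)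

lemma is_sub_eqI:
  assumes "is_sub N A k" "is_sub N B k" "A \<subseteq> B"
  shows "A = B"
  using assms is_sub_finite[OF assms(2)] by (intro card_subset_eq) (auto simp: is_sub_def)

lemma is_sub_zero: "is_sub N {0} 0"
  by (auto simp: is_sub_def is_lsub_iff vecs_def)

lemma is_sub_0_D: "is_sub N W 0 \<Longrightarrow> W = {0}"
  using is_sub_eqI[OF is_sub_zero, of N W] by (auto simp: is_sub_def lsub_zero)

lemma is_sub_line:
  assumes "x \<in> vecs N" "x \<noteq> 0"
  shows "is_sub N (line_plus x {0}) 1"
  using is_sub_line_plus[OF is_sub_zero assms(1)] assms(2) by simp

lemma line_plus_subset:
  assumes "is_lsub V W" "x \<in> W" "G \<subseteq> W"
  shows "line_plus x G \<subseteq> W"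
  using assms(2,3) by (auto simp: line_plus_iff intro!: lsub_add[OF assms(1)] lsub_smul[OF assms(1)])

lemma is_sub_vecs: "is_sub N (vecs N :: (nat \<Rightarrow> 'a::{field,finite}) set) N"
proof (induction N)
  case 0
  have "vecs 0 = {0 :: nat \<Rightarrow> 'a}" by (auto simp: vecs_def)
  then show ?case using is_sub_zero by simp
next
  case (Suc N)
  let ?x = "(\<lambda>i. if i = N then 1 else 0) :: nat \<Rightarrow> 'a"
  have "is_sub (Suc N) (vecs N :: (nat \<Rightarrow> 'a) set) N"
    using Suc lsub_vecs by (auto simp: is_sub_def is_lsub_iff vecs_def)
  then have "is_sub (Suc N) (line_plus ?x (vecs N)) (Suc N)"
    by (rule is_sub_line_plus) (auto simp: vecs_def)
  moreover have "line_plus ?x (vecs N) = vecs (Suc N)"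
  proof
    show "line_plus ?x (vecs N) \<subseteq> vecs (Suc N)"
      by (auto simp: line_plus_iff vecs_def smul_def)
    show "vecs (Suc N) \<subseteq> line_plus ?x (vecs N)"
    proof
      fix v :: "nat \<Rightarrow> 'a" assume "v \<in> vecs (Suc N)"
      then have "v(N := 0) \<in> vecs N" by (auto simp: vecs_def)
      moreover have "v = v N *s ?x + v(N := 0)" by (auto simp: smul_def fun_eq_iff)
      ultimately show "v \<in> line_plus ?x (vecs N)" unfolding line_plus_iff by blast
    qed
  qed
  ultimately show ?case by simp
qed

section \<open>Quadratic forms\<close>

text \<open>The coordinate-free content of a quadratic form. Axioms for both \<open>Q\<close> and
  its polar form are kept because in characteristic two the polar form does not determine
  \<open>Q\<close>.\<close>

locale quadratic =
  fixes Q :: "(nat \<Rightarrow> 'a::{field,finite}) \<Rightarrow> 'a"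
  assumes Q_smul: "Q (c *s v) = c\<^sup>2 * Q v"
    and polar_add_left: "polar Q (u + v) w = polar Q u w + polar Q v w"
    and polar_smul_left: "polar Q (c *s u) w = c * polar Q u w"
begin

lemma polar_commute: "polar Q u v = polar Q v u"
  by (simp add: polar_def fun_ops_eq add.commute)

lemma Q_add: "Q (u + v) = Q u + Q v + polar Q u v"
  by (simp add: polar_def fun_ops_eq)

lemma polar_add_right: "polar Q u (v + w) = polar Q u v + polar Q u w"
  by (metis polar_commute polar_add_left)

lemma polar_smul_right: "polar Q u (c *s v) = c * polar Q u v"
  by (metis polar_commute polar_smul_left)

lemma polar_diff_left: "polar Q (u - v) w = polar Q u w - polar Q v w"
  using polar_add_left[of "u - v" v w] by simp

lemma polar_diff_right: "polar Q u (v - w) = polar Q u v - polar Q u w"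
  using polar_add_right[of u "v - w" w] by simp

lemma Q_zero [simp]: "Q 0 = 0"
  using Q_smul[of 0 0] by simp

lemma polar_zero [simp]: "polar Q 0 u = 0" "polar Q u 0 = 0"
  using polar_smul_left[of 0 0 u] polar_smul_right[of u 0 0] by auto

lemma polar_self: "polar Q u u = 2 * Q u"
proof -
  have "u + u = (2::'a) *s u" by (auto simp: smul_def fun_eq_iff)
  then have "Q (u + u) = 4 * Q u" by (simp add: Q_smul)
  with Q_add[of u u] show ?thesis by (simp add: algebra_simps)
qed

lemmas bilin = Q_smul Q_add polar_add_left polar_add_right polar_smul_left polar_smul_right
  polar_diff_left polar_diff_right

lemma polar_singular:
  assumes "is_lsub V G" "\<forall>v\<in>G. Q v = 0" "u \<in> G" "v \<in> G"
  shows "polar Q u v = 0"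
  using Q_add[of u v] assms lsub_add[OF assms(1,3,4)] by simp

lemma tsing_line_plus:
  assumes G: "tsing N Q W G k" and W: "is_lsub (vecs N) W"
    and x: "x \<in> W" "x \<notin> G" "Q x = 0" "\<forall>g\<in>G. polar Q x g = 0"
  shows "tsing N Q W (line_plus x G) (Suc k)"
proof -
  have "is_sub N (line_plus x G) (Suc k)"
    using G x lsub_subset[OF W] by (intro is_sub_line_plus) (auto simp: tsing_def)
  moreover have "line_plus x G \<subseteq> W"
    using G x by (intro line_plus_subset[OF W]) (auto simp: tsing_def)
  moreover have "\<forall>v\<in>line_plus x G. Q v = 0"
    using G x by (auto simp: line_plus_iff tsing_def bilin)
  ultimately show ?thesis by (simp add: tsing_def)
qed

text \<open>A singular vector of a generator has a non-orthogonal partner by non-singularity, and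
  the two yield a hyperbolic plane. Its complement loses two dimensions while generators lose one,
  so the type \<open>e\<close> is preserved.\<close>

lemma hyperbolic_split:
  assumes nd: "nondeg_quadric N Q W (2 * Suc k + e) e"
  obtains x y where "x \<in> W" "y \<in> W" "Q x = 0" "Q y = 0" "polar Q x y = 1"
    "nondeg_quadric N Q {w\<in>W. polar Q x w = 0 \<and> polar Q y w = 0} (2 * k + e) e"
proof -
  have k: "(2 * Suc k + e - e) div 2 = Suc k" "(2 * k + e - e) div 2 = k" by auto
  have W: "is_sub N W (2 * Suc k + e)" and ns: "nonsingular_on Q W"
    and no: "\<not> (\<exists>G. tsing N Q W G (Suc (Suc k)))"
    using nd by (auto simp: nondeg_quadric_def)
  obtain G where G: "tsing N Q W G (Suc k)"
    using nd unfolding nondeg_quadric_def k by auto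
  have lW: "is_lsub (vecs N) W" using W by (simp add: is_sub_def)
  note cW = lsub_closed[OF lW]
  have sG: "is_sub N G (Suc k)" and lG: "is_lsub (vecs N) G" and GW: "G \<subseteq> W"
    and QG: "\<forall>v\<in>G. Q v = 0"
    using G by (auto simp: tsing_def is_sub_def)
  obtain x where x: "x \<in> G" "x \<noteq> 0" using is_sub_nontrivial[OF sG] .
  have xW: "x \<in> W" and Qx: "Q x = 0" using x GW QG by auto
  have pxx: "polar Q x x = 0" using Qx by (simp add: polar_self)
  obtain z where z: "z \<in> W" "polar Q x z \<noteq> 0"
    using ns xW Qx x(2) unfolding nonsingular_on_def fun_ops_eq by blast
  define y' where "y' = inverse (polar Q x z) *s z"
  have y': "y' \<in> W" "polar Q x y' = 1"
    using z by (auto simp: y'_def bilin intro: cW)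
  \<comment> \<open>Since \<open>Q x = 0\<close> and \<open>polar Q x y' = 1\<close>, the value of
    \<open>Q\<close> at \<open>y' - t *s x\<close> is \<open>Q y' - t\<close>, which vanishes for
    \<open>t = Q y'\<close>.\<close>
  define y where "y = y' - Q y' *s x"
  have yW: "y \<in> W" using y' xW by (auto simp: y_def intro: cW)
  have pxy: "polar Q x y = 1" using y' pxx by (simp add: y_def bilin)
  have Qy: "Q y = 0"
    using Q_add[of y "Q y' *s x"] polar_commute[of x y] pxy Qx by (simp add: y_def bilin)
  have pyx: "polar Q y x = 1" using pxy polar_commute by metis
  have pyy: "polar Q y y = 0" using Qy by (simp add: polar_self)
  define W0 where "W0 = {w\<in>W. polar Q x w = 0 \<and> polar Q y w = 0}"
  have lW0: "is_lsub (vecs N) W0"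
    using lW by (auto simp: is_lsub_iff W0_def bilin)
  have proj: "w - polar Q y w *s x - polar Q x w *s y \<in> W0" if "w \<in> W" for w
    using that xW yW by (auto simp: W0_def bilin pxx pxy pyx pyy intro!: cW)
  \<comment> \<open>Pairing with \<open>y\<close> reads off the coefficient of \<open>x\<close>, and
    pairing with \<open>x\<close> that of \<open>y\<close>.\<close>
  have eqW: "W = line_plus x (line_plus y W0)"
  proof
    show "line_plus x (line_plus y W0) \<subseteq> W"
      by (intro line_plus_subset[OF lW] xW yW) (auto simp: W0_def)
    show "W \<subseteq> line_plus x (line_plus y W0)"
    proof
      fix w assume "w \<in> W"
      let ?a = "polar Q y w" and ?b = "polar Q x w"
      have "?b *s y + (w - ?a *s x - ?b *s y) \<in> line_plus y W0"
        using line_plus_iff proj[OF \<open>w \<in> W\<close>] by blast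
      moreover have "w = ?a *s x + (?b *s y + (w - ?a *s x - ?b *s y))" by simp
      ultimately show "w \<in> line_plus x (line_plus y W0)"
        using line_plus_iff by blast
    qed
  qed
  have yn: "y \<notin> W0" using pxy by (auto simp: W0_def)
  have "polar Q y w = 0" if "w \<in> line_plus y W0" for w
    using that pyy by (auto simp: line_plus_iff bilin W0_def)
  then have xn: "x \<notin> line_plus y W0" using pyx by force
  have "is_lsub (vecs N) (line_plus y W0)"
    using is_lsub_line_plus[OF lW0 lsub_vecs] yW lsub_subset[OF lW] by auto
  from is_sub_line_plus_D[OF _ this xn, of "Suc (2 * k + e)"] W eqW
  have "is_sub N (line_plus y W0) (Suc (2 * k + e))" by simp
  from is_sub_line_plus_D[OF this lW0 yn] have sW0: "is_sub N W0 (2 * k + e)" .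
  \<comment> \<open>Vectors of \<open>W0\<close> are already orthogonal to \<open>x\<close> and
    \<open>y\<close>, so orthogonality to \<open>W0\<close> extends to all of
    \<open>W\<close>.\<close>
  have ns0: "nonsingular_on Q W0"
    unfolding nonsingular_on_def fun_ops_eq
  proof (intro ballI impI)
    fix w assume w: "w \<in> W0" and h: "Q w = 0 \<and> (\<forall>u\<in>W0. polar Q w u = 0)"
    have p0: "polar Q w x = 0" "polar Q w y = 0"
      using w polar_commute by (auto simp: W0_def)
    have "polar Q w u = 0" if "u \<in> W" for u
      using that h p0 unfolding eqW by (auto simp: line_plus_iff bilin)
    then show "w = 0" using ns w h unfolding nonsingular_on_def fun_ops_eq by (auto simp: W0_def)
  qed
  \<comment> \<open>\<open>G\<close> is orthogonal to its own vector \<open>x\<close>, so the part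
    of \<open>G\<close> orthogonal to \<open>y\<close> lies in \<open>W0\<close>. It complements
    \<open>x\<close> in \<open>G\<close> and therefore has dimension \<open>k\<close>.\<close>
  define G0 where "G0 = {g\<in>G. polar Q y g = 0}"
  have lG0: "is_lsub (vecs N) G0" using lG by (auto simp: is_lsub_iff G0_def bilin)
  have eqG: "G = line_plus x G0"
  proof
    show "line_plus x G0 \<subseteq> G"
      by (intro line_plus_subset[OF lG] x) (auto simp: G0_def)
    show "G \<subseteq> line_plus x G0"
    proof
      fix g assume "g \<in> G"
      then show "g \<in> line_plus x G0"
        unfolding line_plus_iff
        by (intro exI[of _ "polar Q y g"] bexI[of _ "g - polar Q y g *s x"])
          (auto simp: G0_def bilin pyx x intro!: lsub_diff[OF lG] lsub_smul[OF lG])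
    qed
  qed
  have "x \<notin> G0" using pyx by (auto simp: G0_def)
  from is_sub_line_plus_D[OF _ lG0 this] sG eqG have "is_sub N G0 k" by simp
  then have t0: "tsing N Q W0 G0 k"
    using QG GW polar_singular[OF lG QG x(1)] by (auto simp: tsing_def G0_def W0_def)
  \<comment> \<open>Adjoining \<open>x\<close> to a larger totally singular subspace of
    \<open>W0\<close> would exceed the bound in \<open>W\<close>.\<close>
  have no0: "\<not> tsing N Q W0 G' (Suc k)" for G'
  proof
    assume G': "tsing N Q W0 G' (Suc k)"
    then have "tsing N Q W G' (Suc k)" by (auto simp: tsing_def W0_def)
    moreover have "x \<notin> G'" using G' pyx by (auto simp: tsing_def W0_def)
    moreover have "\<forall>g\<in>G'. polar Q x g = 0" using G' by (auto simp: tsing_def W0_def)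
    ultimately have "tsing N Q W (line_plus x G') (Suc (Suc k))"
      using tsing_line_plus[OF _ lW xW _ Qx] by blast
    then show False using no by blast
  qed
  have "nondeg_quadric N Q W0 (2 * k + e) e"
    unfolding nondeg_quadric_def k using sW0 ns0 t0 no0 by auto
  then show thesis using that[OF xW yW Qx Qy pxy] by (simp add: W0_def)
qed

text \<open>Generators have dimension \<open>(e - e) div 2 = 0\<close> here, whereas a nonzero
  singular vector would span a totally singular subspace of dimension one.\<close>

lemma anisotropic:
  assumes nd: "nondeg_quadric N Q W e e" and w: "w \<in> W" "w \<noteq> 0"
  shows "Q w \<noteq> 0"
proof
  assume "Q w = 0"
  have W: "is_lsub (vecs N) W" using nd by (simp add: nondeg_quadric_def is_sub_def)
  have "tsing N Q W (line_plus w {0}) 1"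
    using tsing_line_plus[of N W "{0}" 0 w] w W \<open>Q w = 0\<close> is_sub_zero lsub_zero[OF W]
    by (auto simp: tsing_def)
  then show False using nd by (auto simp: nondeg_quadric_def)
qed

end

lemma quadratic_if_quad_form:
  fixes Q :: "(nat \<Rightarrow> 'a::{field,finite}) \<Rightarrow> 'a"
  assumes "quad_form N Q"
  shows "quadratic Q"
proof -
  obtain c where Q: "\<And>v. Q v = (\<Sum>i<N. \<Sum>j\<in>{i..<N}. c i j * v i * v j)"
    using assms unfolding quad_form_def by blast
  have B: "polar Q u v = (\<Sum>i<N. \<Sum>j\<in>{i..<N}. c i j * (u i * v j + v i * u j))" for u v
    unfolding polar_def Q
    by (simp add: sum_subtractf [symmetric] algebra_simps)
  show ?thesis
  proof
    show "Q (c *s v) = c\<^sup>2 * Q v" for c v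
      unfolding Q smul_def by (simp add: sum_distrib_left algebra_simps power2_eq_square)
    show "polar Q (u + v) w = polar Q u w + polar Q v w" for u v w
      unfolding B by (simp add: sum.distrib [symmetric] algebra_simps)
    show "polar Q (c *s u) w = c * polar Q u w" for c u w
      unfolding B smul_def by (simp add: sum_distrib_left algebra_simps)
  qed
qed

section \<open>Anisotropic planes\<close>

text \<open>Each fibre lies in a pair \<open>{x, z}\<close>; the bound is the sum over the
  fibres.\<close>

lemma card_le_twice_card_image:
  assumes "finite X" "\<And>x. x \<in> X \<Longrightarrow> \<exists>z. \<forall>y\<in>X. f y = f x \<longrightarrow> y = x \<or> y = z"
  shows "card X \<le> 2 * card (f ` X)"
proof -
  have "card {y\<in>X. f y = w} \<le> 2" if "w \<in> f ` X" for w
  proof -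
    from that obtain x where x: "x \<in> X" "w = f x" by auto
    obtain z where "\<forall>y\<in>X. f y = f x \<longrightarrow> y = x \<or> y = z" using assms(2)[OF x(1)] by auto
    then have "{y\<in>X. f y = w} \<subseteq> {x, z}" using x by auto
    then have "card {y\<in>X. f y = w} \<le> card {x, z}" by (intro card_mono) auto
    also have "\<dots> \<le> 2" by (cases "x = z") auto
    finally show ?thesis .
  qed
  moreover have "X = (\<Union>w\<in>f ` X. {y\<in>X. f y = w})" by auto
  ultimately show ?thesis
    using card_UN_le[of "f ` X" "\<lambda>w. {y\<in>X. f y = w}"] assms(1)
      sum_bounded_above[of "f ` X" "\<lambda>w. card {y\<in>X. f y = w}" 2]
    by (simp add: mult.commute)
qed

text \<open>The image of an at most two-to-one map fills half of the set, so a disjoint injective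
  copy of the image is the whole complement.\<close>
lemma two_to_one_cover:
  assumes fin: "finite X" and fib: "\<And>x. x \<in> X \<Longrightarrow> \<exists>z. \<forall>y\<in>X. f y = f x \<longrightarrow> y = x \<or> y = z"
    and f: "f ` X \<subseteq> X" and t: "inj_on t (f ` X)" "t ` f ` X \<subseteq> X" "f ` X \<inter> t ` f ` X = {}"
    and d: "d \<in> X" "d \<notin> f ` X"
  shows "d \<in> t ` f ` X"
proof -
  have "card (f ` X \<union> t ` f ` X) = 2 * card (f ` X)"
    using fin t by (subst card_Un_disjoint) (auto simp: card_image)
  then have "f ` X \<union> t ` f ` X = X"
    using card_le_twice_card_image[OF fin fib] f t fin by (intro card_seteq) auto
  with d show ?thesis by blast
qed

text \<open>Squaring is at most two-to-one on nonzero elements, and the nonsquare \<open>D'\<close>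
  times the nonzero squares is disjoint from the squares. Hence these multiples cover every
  nonsquare.\<close>

lemma nonsquare_ratio:
  fixes D D' :: "'a::{field,finite}"
  assumes "\<And>s. s\<^sup>2 \<noteq> D" "\<And>s. s\<^sup>2 \<noteq> D'"
  obtains s where "D = s\<^sup>2 * D'"
proof -
  have nz: "D \<noteq> 0" "D' \<noteq> 0" using assms(1)[of 0] assms(2)[of 0] by auto
  have "D \<in> (\<lambda>s. D' * s) ` (\<lambda>s. s\<^sup>2) ` (UNIV - {0})"
  proof (rule two_to_one_cover[where X = "UNIV - {0}"])
    show "\<exists>z. \<forall>y\<in>UNIV - {0}. y\<^sup>2 = x\<^sup>2 \<longrightarrow> y = x \<or> y = z" for x :: 'a
      by (rule exI[of _ "- x"]) (auto simp: power2_eq_iff)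
    show "(\<lambda>s. s\<^sup>2) ` (UNIV - {0}) \<inter> (\<lambda>s. D' * s) ` (\<lambda>s. s\<^sup>2) ` (UNIV - {0}) = {}"
    proof -
      have False if "s\<^sup>2 = D' * t\<^sup>2" "t \<noteq> 0" for s t :: 'a
        using assms(2)[of "s / t"] that by (simp add: power_divide)
      then show ?thesis by auto
    qed
  qed (use nz assms(1) in \<open>auto simp: inj_on_def\<close>)
  then obtain s where "D = D' * s\<^sup>2" by blast
  with that[of s] show thesis by (simp add: mult.commute)
qed

text \<open>In characteristic two \<open>s\<^sup>2 + s\<close> is additive and two-to-one. Its image
  and the translate of the image by \<open>g'\<close> fill the field, so \<open>g\<close> lies in
  that translate.\<close>

lemma artin_schreier_sum:
  fixes g g' :: "'a::{field,finite}"
  assumes two: "(2::'a) = 0" and "\<And>s. s\<^sup>2 + s \<noteq> g" "\<And>s. s\<^sup>2 + s \<noteq> g'"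
  obtains s where "s\<^sup>2 + s = g + g'"
proof -
  have minus: "- x = x" for x :: 'a
    using two by (metis add.inverse_unique mult_2 mult_zero_left)
  have "g \<in> (\<lambda>s. g' + s) ` (\<lambda>s. s\<^sup>2 + s) ` UNIV"
  proof (rule two_to_one_cover[where X = UNIV])
    show "\<exists>z. \<forall>y\<in>UNIV. y\<^sup>2 + y = x\<^sup>2 + x \<longrightarrow> y = x \<or> y = z" for x :: 'a
    proof (rule exI[of _ "- x - 1"], intro ballI impI)
      fix y assume "y\<^sup>2 + y = x\<^sup>2 + x"
      then have "(y - x) * (y + x + 1) = 0" by algebra
      moreover have "y + x + 1 = y - (- x - 1)" by simp
      ultimately show "y = x \<or> y = - x - 1" by (simp only: mult_eq_0_iff right_minus_eq)
    qed
    show "(\<lambda>s. s\<^sup>2 + s) ` UNIV \<inter> (\<lambda>s. g' + s) ` (\<lambda>s. s\<^sup>2 + s) ` UNIV = {}"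
    proof -
      have False if "s\<^sup>2 + s = g' + (t\<^sup>2 + t)" for s t :: 'a
      proof -
        have "(s - t)\<^sup>2 + (s - t) = (s\<^sup>2 + s) - (t\<^sup>2 + t) + 2 * (t\<^sup>2 - s * t)"
          by (simp add: power2_eq_square algebra_simps)
        then have "(s - t)\<^sup>2 + (s - t) = g'" using that two by simp
        then show False using assms(3) by blast
      qed
      then show ?thesis by auto
    qed
  qed (use assms(2) in \<open>auto simp: inj_on_def\<close>)
  then obtain s where "g = g' + (s\<^sup>2 + s)" by auto
  then have "s\<^sup>2 + s = g + g'" using minus[of g'] by (metis add.commute add_diff_cancel_left' diff_conv_add_uminus)
  with that show thesis by blast
qed

text \<open>Any two monic quadratic polynomials without roots differ by an affine substitution
  \<open>t \<mapsto> a t + d\<close> and rescaling.\<close>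
lemma rootless_quadratics_equivalent:
  fixes b g b' g' :: "'a::{field,finite}"
  assumes n: "\<And>t. t\<^sup>2 + b * t + g \<noteq> 0" "\<And>t. t\<^sup>2 + b' * t + g' \<noteq> 0"
  obtains a d where "a * b' + 2 * d = b" "a\<^sup>2 * g' + a * d * b' + d\<^sup>2 = g"
proof (cases "(2::'a) = 0")
  case False
  \<comment> \<open>Completing the square: a square discriminant would give the root
    \<open>(s - b) / 2\<close>.\<close>
  have ns: "s\<^sup>2 \<noteq> b\<^sup>2 - 4 * g" if h: "\<And>t. t\<^sup>2 + b * t + g \<noteq> 0" for s b g :: 'a
  proof
    assume s: "s\<^sup>2 = b\<^sup>2 - 4 * g"
    define t where "t = (s - b) / 2"
    have "2 * t = s - b" using False by (simp add: t_def)
    then have "2 * 2 * (t\<^sup>2 + b * t + g) = 0" using s by algebra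
    then show False using h[of t] False by (simp only: mult_eq_0_iff) simp
  qed
  obtain a where a: "b\<^sup>2 - 4 * g = a\<^sup>2 * (b'\<^sup>2 - 4 * g')"
    using nonsquare_ratio[OF ns[OF n(1)] ns[OF n(2)]] .
  define d where "d = (b - a * b') / 2"
  have d: "2 * d = b - a * b'" using False by (simp add: d_def)
  have four: "(2 * 2 :: 'a) \<noteq> 0" using False by (simp only: mult_eq_0_iff) simp
  have "2 * 2 * (a\<^sup>2 * g' + a * d * b' + d\<^sup>2) = 2 * 2 * g" using a d by algebra
  then have "a\<^sup>2 * g' + a * d * b' + d\<^sup>2 = g" by (rule mult_left_cancel[OF four, THEN iffD1])
  with that[of a d] d show thesis by simp
next
  case two: True
  have minus: "- x = x" for x :: 'a
    using two by (metis add.inverse_unique mult_2 mult_zero_left)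
  have "inj (\<lambda>s :: 'a. s\<^sup>2)" using minus by (auto simp: inj_on_def power2_eq_iff)
  then have "surj (\<lambda>s :: 'a. s\<^sup>2)" by (simp add: finite_UNIV_inj_surj)
  then have sq: "\<exists>s. s\<^sup>2 = g" for g :: 'a by (metis surjD)
  \<comment> \<open>Without a linear term, a square root of \<open>- g\<close> would be a
    root.\<close>
  have nz: "b \<noteq> 0" if h: "\<And>t. t\<^sup>2 + b * t + g \<noteq> 0" for b g :: 'a
  proof
    assume "b = 0"
    obtain s where "s\<^sup>2 = - g" using sq by blast
    then show False using h[of s] \<open>b = 0\<close> by simp
  qed
  \<comment> \<open>The substitution \<open>t = b * s\<close> brings the polynomial into
    Artin-Schreier shape.\<close>
  have as: "s\<^sup>2 + s \<noteq> g / b\<^sup>2" if h: "\<And>t. t\<^sup>2 + b * t + g \<noteq> 0" for s b g :: 'a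
  proof
    assume s: "s\<^sup>2 + s = g / b\<^sup>2"
    then have "b\<^sup>2 * (s\<^sup>2 + s) = g" using nz[OF h] by simp
    moreover have "(b * s)\<^sup>2 + b * (b * s) = b\<^sup>2 * (s\<^sup>2 + s)"
      by (simp add: power2_eq_square algebra_simps)
    ultimately have "(b * s)\<^sup>2 + b * (b * s) + g = 0" using minus[of g] by (simp add: add_eq_0_iff)
    then show False using h by blast
  qed
  obtain s where s: "s\<^sup>2 + s = g / b\<^sup>2 + g' / b'\<^sup>2"
    using artin_schreier_sum[OF two as[OF n(1)] as[OF n(2)]] .
  \<comment> \<open>As \<open>2 = 0\<close>, the first equation reads \<open>a * b' = b\<close> and
    forces \<open>a\<close>; the second is then solved by \<open>d = b * s\<close>.\<close>
  define a where "a = b / b'"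
  have ab: "a * b' = b" using nz[OF n(2)] by (simp add: a_def)
  have "b\<^sup>2 * (s\<^sup>2 + s) = g + a\<^sup>2 * g'"
    unfolding s using nz[OF n(1)] nz[OF n(2)] by (simp add: a_def field_simps)
  then have "a\<^sup>2 * g' + a * (b * s) * b' + (b * s)\<^sup>2 = g + 2 * (a\<^sup>2 * g')" using ab by algebra
  then have "a\<^sup>2 * g' + a * (b * s) * b' + (b * s)\<^sup>2 = g" using two by simp
  with that[of a "b * s"] ab two show thesis by simp
qed

section \<open>Similitudes\<close>

definition linear_on :: "(nat \<Rightarrow> 'a::field) set \<Rightarrow> ((nat \<Rightarrow> 'a) \<Rightarrow> nat \<Rightarrow> 'a) \<Rightarrow> bool" where
  "linear_on W f \<longleftrightarrow> (\<forall>u\<in>W. \<forall>w\<in>W. f (u + w) = f u + f w) \<and> (\<forall>c. \<forall>w\<in>W. f (c *s w) = c *s f w)"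

lemma linear_on_add: "linear_on W f \<Longrightarrow> u \<in> W \<Longrightarrow> w \<in> W \<Longrightarrow> f (u + w) = f u + f w"
  and linear_on_smul: "linear_on W f \<Longrightarrow> w \<in> W \<Longrightarrow> f (c *s w) = c *s f w"
  by (auto simp: linear_on_def)

lemma linear_on_zero: "linear_on W f \<Longrightarrow> 0 \<in> W \<Longrightarrow> f 0 = 0"
  using linear_on_smul[of W f 0 0] by simp

lemma linear_on_inj:
  assumes f: "linear_on W f" and W: "is_lsub V W" and ker: "\<And>w. w \<in> W \<Longrightarrow> f w = 0 \<Longrightarrow> w = 0"
  shows "inj_on f W"
proof (rule inj_onI)
  fix u w assume uw: "u \<in> W" "w \<in> W" "f u = f w"
  then have "f (u - w) = 0"
    using linear_on_add[OF f lsub_diff[OF W uw(1,2)] uw(2)] by simp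
  then show "u = w" using ker[OF lsub_diff[OF W uw(1,2)]] by simp
qed

lemma is_sub_image:
  assumes f: "linear_on W f" "inj_on f W" and W: "is_sub N W k" and im: "f ` W \<subseteq> vecs M"
  shows "is_sub M (f ` W) k"
proof -
  have lW: "is_lsub (vecs N) W" using W by (simp add: is_sub_def)
  have "u + w \<in> f ` W" if uw: "u \<in> f ` W" "w \<in> f ` W" for u w
  proof -
    from uw obtain a b where "a \<in> W" "b \<in> W" "u = f a" "w = f b" by auto
    then show ?thesis
      by (intro image_eqI[of _ _ "a + b"]) (auto simp: linear_on_add[OF f(1)] intro: lsub_add[OF lW])
  qed
  moreover have "c *s w \<in> f ` W" if "w \<in> f ` W" for c w
  proof -
    from that obtain b where "b \<in> W" "w = f b" by auto
    then show ?thesis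
      by (intro image_eqI[of _ _ "c *s b"]) (auto simp: linear_on_smul[OF f(1)] intro: lsub_smul[OF lW])
  qed
  moreover have "0 \<in> f ` W"
    using linear_on_zero[OF f(1) lsub_zero[OF lW]] lsub_zero[OF lW] by force
  ultimately show ?thesis
    using im W card_image[OF f(2)] by (auto simp: is_sub_def is_lsub_iff)
qed

text \<open>The new basis vector can be sent to any \<open>z\<close>. Decompositions in
  \<open>line_plus x G\<close> are unique, so the description by \<open>THE\<close> is well
  defined.\<close>

lemma linear_on_line_plus_extend:
  assumes G: "is_lsub V G" and x: "x \<notin> G" and f: "linear_on G f"
  obtains f' where "linear_on (line_plus x G) f'" "\<And>a g. g \<in> G \<Longrightarrow> f' (a *s x + g) = a *s z + f g"
proof -
  define f' where "f' w = (THE v. \<exists>a. \<exists>g\<in>G. w = a *s x + g \<and> v = a *s z + f g)" for w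
  have f': "f' (a *s x + g) = a *s z + f g" if "g \<in> G" for a g
    unfolding f'_def
  proof (rule the_equality)
    show "\<exists>b. \<exists>h\<in>G. a *s x + g = b *s x + h \<and> a *s z + f g = b *s z + f h" using that by blast
  qed (use that line_plus_unique[OF G x] in blast)
  have "f' (u + w) = f' u + f' w" if uw: "u \<in> line_plus x G" "w \<in> line_plus x G" for u w
  proof -
    from uw obtain a g b h where gh: "g \<in> G" "h \<in> G" "u = a *s x + g" "w = b *s x + h"
      by (auto simp: line_plus_iff)
    then have "u + w = (a + b) *s x + (g + h)" by (simp add: smul_distribs)
    then show ?thesis
      using gh by (simp only: f' lsub_add[OF G]) (simp add: smul_distribs linear_on_add[OF f])
  qed
  moreover have "f' (c *s w) = c *s f' w" if w: "w \<in> line_plus x G" for c w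
  proof -
    from w obtain b h where h: "h \<in> G" "w = b *s x + h" by (auto simp: line_plus_iff)
    then have "c *s w = (c * b) *s x + c *s h" by (simp add: smul_distribs)
    then show ?thesis
      using h by (simp only: f' lsub_smul[OF G]) (simp add: smul_distribs linear_on_smul[OF f])
  qed
  ultimately have "linear_on (line_plus x G) f'" by (simp add: linear_on_def)
  then show thesis using that f' by blast
qed

text \<open>Forms of one type need not be isometric, hence the factor \<open>c\<close>: for nonzero
  \<open>a\<close> and \<open>b\<close>, the one-dimensional forms \<open>a * t\<^sup>2\<close> and
  \<open>b * t\<^sup>2\<close> are isometric only if \<open>a / b\<close> is a square.\<close>

definition similitude ::
  "((nat \<Rightarrow> 'a::field) \<Rightarrow> 'a) \<Rightarrow> (nat \<Rightarrow> 'a) set \<Rightarrow> ((nat \<Rightarrow> 'a) \<Rightarrow> 'a) \<Rightarrow> (nat \<Rightarrow> 'a) set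
    \<Rightarrow> 'a \<Rightarrow> ((nat \<Rightarrow> 'a) \<Rightarrow> nat \<Rightarrow> 'a) \<Rightarrow> bool" where
  "similitude Q W Q' W' c f \<longleftrightarrow>
     c \<noteq> 0 \<and> linear_on W f \<and> f ` W \<subseteq> W' \<and> (\<forall>w\<in>W. Q' (f w) = c * Q w)"

text \<open>Polarising \<open>Q' (f w) = c * Q w\<close> shows that a kernel vector is singular and
  orthogonal to all of \<open>W\<close>.\<close>

lemma similitude_inj:
  assumes Q: "quadratic Q" and Q': "quadratic Q'" and W: "is_lsub V W"
    and ns: "nonsingular_on Q W" and f: "similitude Q W Q' W' c f"
  shows "inj_on f W"
proof -
  interpret Q: quadratic Q by fact
  interpret Q': quadratic Q' by fact
  have c: "c \<noteq> 0" and lin: "linear_on W f" and Qf: "\<And>w. w \<in> W \<Longrightarrow> Q' (f w) = c * Q w"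
    using f by (auto simp: similitude_def)
  show ?thesis
  proof (rule linear_on_inj[OF lin W])
    fix w assume w: "w \<in> W" "f w = 0"
    have "Q w = 0" using Qf[OF w(1)] w(2) c by simp
    moreover have "polar Q w u = 0" if u: "u \<in> W" for u
      using Qf[OF lsub_add[OF W w(1) u]] Qf[OF u] w u c \<open>Q w = 0\<close>
      by (simp add: linear_on_add[OF lin] Q.Q_add)
    ultimately show "w = 0" using ns w unfolding nonsingular_on_def fun_ops_eq by blast
  qed
qed

text \<open>In dimension one a scalar adjusts the form. In dimension two, \<open>Q\<close> on
  \<open>t *s x + y\<close> is \<open>Q x\<close> times a monic polynomial in \<open>t\<close>
  without roots, and any two such polynomials are equivalent.\<close>

lemma similitude_anisotropic:
  fixes Q Q' :: "(nat \<Rightarrow> 'a::{field,finite}) \<Rightarrow> 'a"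
  assumes Q: "quadratic Q" and Q': "quadratic Q'" and e: "e \<le> 2"
    and nd: "nondeg_quadric N Q W e e" and nd': "nondeg_quadric N' Q' W' e e"
  shows "\<exists>c f. similitude Q W Q' W' c f"
proof -
  interpret Q: quadratic Q by fact
  interpret Q': quadratic Q' by fact
  have W: "is_sub N W e" and W': "is_sub N' W' e"
    using nd nd' by (auto simp: nondeg_quadric_def)
  have lW: "is_lsub (vecs N) W" and lW': "is_lsub (vecs N') W'"
    using W W' by (auto simp: is_sub_def)
  note V = lsub_subset[OF lW] and V' = lsub_subset[OF lW']
  note an = Q.anisotropic[OF nd] and an' = Q'.anisotropic[OF nd']
  have lin0: "linear_on {0 :: nat \<Rightarrow> 'a} (\<lambda>_. 0)" by (auto simp: linear_on_def)
  have l0: "is_lsub (vecs N) {0 :: nat \<Rightarrow> 'a}" using is_sub_zero[of N] unfolding is_sub_def by blast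
  consider "e = 0" | "e = 1" | "e = 2" using e by linarith
  then show ?thesis
  proof cases
    case 1
    then have "W = {0}" using W is_sub_0_D by blast
    then have "similitude Q W Q' W' 1 (\<lambda>_. 0)"
      using lin0 lsub_zero[OF lW'] by (auto simp: similitude_def)
    then show ?thesis by blast
  next
    case 2
    obtain x where x: "x \<in> W" "x \<noteq> 0" using is_sub_nontrivial[of N W 0] W 2 by auto
    obtain x' where x': "x' \<in> W'" "x' \<noteq> 0" using is_sub_nontrivial[of N' W' 0] W' 2 by auto
    have eqW: "line_plus x {0} = W"
      using is_sub_eqI[OF is_sub_line, of x N W] line_plus_subset[OF lW x(1)] lsub_zero[OF lW] x V W 2
      by auto
    obtain f where f: "linear_on (line_plus x {0}) f" "\<And>a g. g \<in> {0} \<Longrightarrow> f (a *s x + g) = a *s x' + 0"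
      using linear_on_line_plus_extend[OF l0 _ lin0, of x x'] x by auto
    have fx: "f (a *s x) = a *s x'" for a using f(2)[of 0 a] by simp
    \<comment> \<open>The values at \<open>x\<close> and \<open>x'\<close> dictate the
      factor.\<close>
    have "similitude Q W Q' W' (Q' x' / Q x) f"
      unfolding similitude_def
    proof (intro conjI ballI)
      show "Q' x' / Q x \<noteq> 0" using an[OF x] an'[OF x'] by simp
      show "linear_on W f" using f eqW by simp
      show "f ` W \<subseteq> W'" using lsub_smul[OF lW' x'(1)] eqW fx by (auto simp: line_plus_iff)
      show "Q' (f w) = Q' x' / Q x * Q w" if "w \<in> W" for w
        using that an[OF x] fx unfolding eqW[symmetric] by (auto simp: line_plus_iff Q.Q_smul Q'.Q_smul)
    qed
    then show ?thesis by blast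
  next
    case 3
    have basis: "\<exists>x y. x \<in> W \<and> x \<noteq> 0 \<and> y \<in> W \<and> y \<notin> line_plus x {0}"
      if "is_sub N W 2" for N and W :: "(nat \<Rightarrow> 'a) set"
    proof -
      have lW: "is_lsub (vecs N) W" using that by (simp add: is_sub_def)
      have "is_sub N W (Suc 1)" using that by (simp add: numeral_2_eq_2)
      then obtain x where x: "x \<in> W" "x \<noteq> 0" by (rule is_sub_nontrivial)
      have "is_sub N (line_plus x {0}) 1" using is_sub_line x lsub_subset[OF lW] by auto
      then have "\<not> W \<subseteq> line_plus x {0}"
        using that card_field_ge_2[where 'a='a] is_sub_finite[of N "line_plus x {0}" 1]
          card_mono[of "line_plus x {0}" W]
        by (auto simp: is_sub_def power2_eq_square)
      then show ?thesis using x by blast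
    qed
    obtain x y where x: "x \<in> W" "x \<noteq> 0" and y: "y \<in> W" "y \<notin> line_plus x {0}"
      using basis[of N W] W 3 by blast
    obtain x' y' where x': "x' \<in> W'" "x' \<noteq> 0" and y': "y' \<in> W'" "y' \<notin> line_plus x' {0}"
      using basis[of N' W'] W' 3 by blast
    have sx: "is_sub N (line_plus x {0}) 1" using is_sub_line x V by auto
    have eqW: "line_plus y (line_plus x {0}) = W"
    proof (rule is_sub_eqI)
      show "is_sub N (line_plus y (line_plus x {0})) 2"
        using is_sub_line_plus[OF sx _ y(2)] y V by (auto simp: numeral_2_eq_2)
      show "line_plus y (line_plus x {0}) \<subseteq> W"
        using lsub_zero[OF lW] by (intro line_plus_subset[OF lW] x y) auto
    qed (use W 3 in auto)
    \<comment> \<open>A root \<open>t\<close> would make \<open>t *s x + y\<close> a nonzero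
      singular vector.\<close>
    have rootless: "t\<^sup>2 + polar Q x y / Q x * t + Q y / Q x \<noteq> 0"
      if "quadratic Q" "is_lsub V W" "\<And>w. w \<in> W \<Longrightarrow> w \<noteq> 0 \<Longrightarrow> Q w \<noteq> 0"
        "x \<in> W" "x \<noteq> 0" "y \<in> W" "y \<notin> line_plus x {0}"
      for t V W x y and Q :: "(nat \<Rightarrow> 'a) \<Rightarrow> 'a"
    proof
      assume *: "t\<^sup>2 + polar Q x y / Q x * t + Q y / Q x = 0"
      interpret quadratic Q by fact
      have "Q x \<noteq> 0" using that by blast
      have "t *s x + y \<in> W" using that(4,6) by (intro lsub_closed[OF that(2)])
      moreover have "t *s x + y \<noteq> 0"
      proof
        assume "t *s x + y = 0"
        then have "y = (- t) *s x + 0" by (simp add: eq_neg_iff_add_eq_0 add.commute)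
        then show False using that(7) unfolding line_plus_iff by blast
      qed
      ultimately have "Q (t *s x + y) \<noteq> 0" using that(3) by blast
      moreover have "Q (t *s x + y) = Q x * (t\<^sup>2 + polar Q x y / Q x * t + Q y / Q x)"
        using \<open>Q x \<noteq> 0\<close> by (simp add: bilin field_simps polar_commute[of y x])
      ultimately show False using * by simp
    qed
    obtain a d where ad: "a * (polar Q' x' y' / Q' x') + 2 * d = polar Q x y / Q x"
      "a\<^sup>2 * (Q' y' / Q' x') + a * d * (polar Q' x' y' / Q' x') + d\<^sup>2 = Q y / Q x"
      using rootless_quadratics_equivalent[OF rootless[OF Q lW an x y] rootless[OF Q' lW' an' x' y']]
      by blast
    \<comment> \<open>\<open>z\<close> will be the image of \<open>y\<close>, and \<open>x'\<close>
      that of \<open>x\<close>. The coefficients \<open>a\<close> and \<open>d\<close> make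
      \<open>polar Q' x' z\<close> and \<open>Q' z\<close> equal to \<open>c\<close> times their
      counterparts.\<close>
    define z where "z = a *s y' + d *s x'"
    define c where "c = Q' x' / Q x"
    have nz: "Q x \<noteq> 0" "Q' x' \<noteq> 0" using an[OF x] an'[OF x'] by auto
    have zW: "z \<in> W'" unfolding z_def by (intro lsub_closed[OF lW'] x' y')
    have "polar Q' x' z = Q' x' * (a * (polar Q' x' y' / Q' x') + 2 * d)"
      using nz by (simp add: z_def Q'.bilin Q'.polar_self field_simps)
    then have pz: "polar Q' x' z = c * polar Q x y" unfolding ad c_def by simp
    have "Q' z = Q' x' * (a\<^sup>2 * (Q' y' / Q' x') + a * d * (polar Q' x' y' / Q' x') + d\<^sup>2)"
      using nz by (simp add: z_def Q'.bilin Q'.polar_commute[of y' x'] field_simps)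
    then have Qz: "Q' z = c * Q y" unfolding ad c_def by simp
    have Qx': "Q' x' = c * Q x" using nz by (simp add: c_def)
    obtain f1 where f1: "linear_on (line_plus x {0}) f1"
      "\<And>a g. g \<in> {0} \<Longrightarrow> f1 (a *s x + g) = a *s x' + 0"
      using linear_on_line_plus_extend[OF l0 _ lin0, of x x'] x by auto
    have lx: "is_lsub (vecs N) (line_plus x {0})" using sx by (simp add: is_sub_def)
    obtain f where f: "linear_on (line_plus y (line_plus x {0})) f"
      "\<And>a g. g \<in> line_plus x {0} \<Longrightarrow> f (a *s y + g) = a *s z + f1 g"
      using linear_on_line_plus_extend[OF lx y(2) f1(1), of z] by blast
    have fxy: "f (b *s y + a *s x) = b *s z + a *s x'" for a b
      using f(2)[of "a *s x" b] f1(2)[of 0 a] by (auto simp: line_plus_iff)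
    have W_iff: "w \<in> W \<longleftrightarrow> (\<exists>a b. w = b *s y + a *s x)" for w
    proof
      assume "w \<in> W"
      then obtain b g where g: "g \<in> line_plus x {0}" "w = b *s y + g"
        unfolding eqW[symmetric] line_plus_iff[of w] by metis
      moreover obtain a where "g = a *s x" using g(1) unfolding line_plus_iff by auto
      ultimately show "\<exists>a b. w = b *s y + a *s x" by metis
    next
      assume "\<exists>a b. w = b *s y + a *s x"
      then show "w \<in> W" using x y by (auto intro!: lsub_add[OF lW] lsub_smul[OF lW])
    qed
    have "similitude Q W Q' W' c f"
      unfolding similitude_def
    proof (intro conjI ballI)
      show "c \<noteq> 0" using nz by (simp add: c_def)
      show "linear_on W f" using f eqW by simp
      show "f ` W \<subseteq> W'" using x' zW by (auto simp: W_iff fxy intro!: lsub_add[OF lW'] lsub_smul[OF lW'])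
      show "Q' (f w) = c * Q w" if "w \<in> W" for w
      proof -
        from that obtain a b where w: "w = b *s y + a *s x" by (auto simp: W_iff)
        show ?thesis
          unfolding w fxy
          by (simp add: Q.bilin Q'.bilin Q'.polar_commute[of z x'] Q.polar_commute[of y x] pz Qz Qx' algebra_simps)
      qed
    qed
    then show ?thesis by blast
  qed
qed

text \<open>Induction on the number of hyperbolic planes: one is split off on either side, and the
  similitude of the complements is extended. The factor \<open>c\<close> comes from the anisotropic
  parts.\<close>

lemma similitude_exists:
  assumes Q: "quadratic Q" and Q': "quadratic Q'" and e: "e \<le> 2"
    and nd: "nondeg_quadric N Q W (2 * k + e) e" and nd': "nondeg_quadric N' Q' W' (2 * k + e) e"
  shows "\<exists>c f. similitude Q W Q' W' c f"
  using nd nd'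
proof (induction k arbitrary: W W')
  case 0
  then show ?case using similitude_anisotropic[OF Q Q' e] by simp
next
  case (Suc k)
  interpret Q: quadratic Q by fact
  interpret Q': quadratic Q' by fact
  have lW: "is_lsub (vecs N) W" and lW': "is_lsub (vecs N') W'"
    using Suc.prems by (auto simp: nondeg_quadric_def is_sub_def)
  obtain x y where xW: "x \<in> W" and yW: "y \<in> W" and Qxy: "Q x = 0" "Q y = 0" and xy: "polar Q x y = 1"
    and nd0: "nondeg_quadric N Q {w\<in>W. polar Q x w = 0 \<and> polar Q y w = 0} (2 * k + e) e"
    by (rule Q.hyperbolic_split[OF Suc.prems(1)])
  obtain x' y' where xW': "x' \<in> W'" and yW': "y' \<in> W'" and Qxy': "Q' x' = 0" "Q' y' = 0"
    and xy': "polar Q' x' y' = 1"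
    and nd0': "nondeg_quadric N' Q' {w\<in>W'. polar Q' x' w = 0 \<and> polar Q' y' w = 0} (2 * k + e) e"
    by (rule Q'.hyperbolic_split[OF Suc.prems(2)])
  note x = xW Qxy(1) and y = yW Qxy(2) and x' = xW' Qxy'(1) and y' = yW' Qxy'(2)
  define W0 where "W0 = {w\<in>W. polar Q x w = 0 \<and> polar Q y w = 0}"
  define W0' where "W0' = {w\<in>W'. polar Q' x' w = 0 \<and> polar Q' y' w = 0}"
  obtain c f where "similitude Q W0 Q' W0' c f"
    using Suc.IH[OF nd0 nd0'] unfolding W0_def W0'_def by blast
  then have c: "c \<noteq> 0" and lin: "linear_on W0 f" and im: "\<And>w. w \<in> W0 \<Longrightarrow> f w \<in> W0'"
    and Qf: "\<And>w. w \<in> W0 \<Longrightarrow> Q' (f w) = c * Q w"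
    by (auto simp: similitude_def)
  \<comment> \<open>The projection onto \<open>W0\<close> along the hyperbolic pair.\<close>
  define p where "p w = w - polar Q y w *s x - polar Q x w *s y" for w
  have yx: "polar Q y x = 1" using xy Q.polar_commute by metis
  have pW: "p w \<in> W0" if "w \<in> W" for w
    unfolding W0_def p_def
    using that x y xy yx by (auto simp: Q.bilin Q.polar_self intro!: lsub_diff[OF lW] lsub_smul[OF lW])
  have p_add: "p (u + w) = p u + p w" for u w
    by (simp add: p_def Q.bilin smul_distribs)
  have p_smul: "p (a *s w) = a *s p w" for a w
    by (simp add: p_def Q.bilin smul_distribs)
  \<comment> \<open>Only the coefficient of \<open>x'\<close> is scaled, so that the product of the
    two coefficients picks up \<open>c\<close> exactly once.\<close>
  define F where "F w = (c * polar Q y w) *s x' + polar Q x w *s y' + f (p w)" for w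
  have "similitude Q W Q' W' c F"
    unfolding similitude_def
  proof (intro conjI ballI)
    show "linear_on W F"
      unfolding linear_on_def F_def
      by (auto simp: p_add p_smul linear_on_add[OF lin] linear_on_smul[OF lin] pW Q.bilin smul_distribs algebra_simps)
    have "f (p w) \<in> W'" if "w \<in> W" for w using im[OF pW[OF that]] by (simp add: W0'_def)
    then show "F ` W \<subseteq> W'"
      using x' y' by (auto simp: F_def intro!: lsub_add[OF lW'] lsub_smul[OF lW'])
    show "Q' (F w) = c * Q w" if w: "w \<in> W" for w
    proof -
      let ?a = "polar Q y w" and ?b = "polar Q x w"
      have p: "polar Q x (p w) = 0" "polar Q y (p w) = 0" using pW[OF w] by (auto simp: W0_def)
      have "polar Q' x' (f (p w)) = 0" "polar Q' y' (f (p w)) = 0"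
        using im[OF pW[OF w]] by (auto simp: W0'_def)
      then have "Q' (F w) = c * (?a * ?b) + c * Q (p w)"
        using x' y' xy' Qf[OF pW[OF w]] by (simp add: F_def Q'.bilin)
      moreover have "w = ?a *s x + ?b *s y + p w" by (simp add: p_def)
      then have "Q w = Q (?a *s x + ?b *s y + p w)" by simp
      then have "Q w = ?a * ?b + Q (p w)" using x y xy p by (simp add: Q.bilin)
      ultimately show ?thesis by (simp add: algebra_simps)
    qed
  qed (rule c)
  then show ?case by blast
qed

section \<open>The spread\<close>

text \<open>Vectors are handled in coordinates \<open>a *s x + b *s y + f g\<close> with
  \<open>g \<in> H\<close>, where \<open>Q2\<close> becomes \<open>a * b + c * Q g\<close>;
  \<open>k\<close> is the dimension of the generators in \<open>H\<close>.\<close>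

lemma spread_from_avsp:
  fixes H Pi :: "(nat \<Rightarrow> 'a::{field,finite}) set"
  assumes Q: "quadratic Q" and Q2: "quadratic Q2"
    and avsp: "special_avsp r e H Q Pi P"
    and k: "r + 1 = 2 * k + e"
    and xy: "x \<in> vecs (r + 3)" "y \<in> vecs (r + 3)" "Q2 x = 0" "Q2 y = 0" "polar Q2 x y = 1"
    and W0: "W0 = {w\<in>vecs (r + 3). polar Q2 x w = 0 \<and> polar Q2 y w = 0}"
    and sim: "similitude Q H Q2 W0 c f"
  shows "\<exists>\<Sigma>. is_spread (r + 3) Q2 (vecs (r + 3)) (r + 3) e \<Sigma>"
proof -
  interpret Q: quadratic Q by fact
  interpret Q2: quadratic Q2 by fact
  let ?q = "card (UNIV :: 'a set)"
  have dims: "(r + 1 - e) div 2 = k" "(r + 3 - e) div 2 = Suc k"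
    "(r + 3 + e - 2) div 2 = (r + e + 1) div 2"
    using k by auto
  note av = avsp[unfolded special_avsp_def dims fun_ops_eq]
  have sH: "is_sub (r + 2) H (r + 1)" and nd: "nondeg_quadric (r + 2) Q H (r + 1) e"
    and gPi: "tsing (r + 2) Q H Pi k"
    and cP: "card P = ?q ^ ((r + e + 1) div 2)"
    and sS: "\<And>S. S \<in> P \<Longrightarrow> is_sub (r + 2) S (Suc k)"
    and SH: "\<And>S. S \<in> P \<Longrightarrow> \<not> S \<subseteq> H"
    and part: "\<And>X. is_sub (r + 2) X 1 \<Longrightarrow> \<not> X \<subseteq> H \<Longrightarrow> \<exists>!S. S \<in> P \<and> X \<subseteq> S"
    and gS: "\<And>S. S \<in> P \<Longrightarrow> tsing (r + 2) Q H (S \<inter> H) k"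
    and SPi: "\<And>S. S \<in> P \<Longrightarrow> S \<inter> H \<inter> Pi = {0}"
    and small: "\<And>S S'. S \<in> P \<Longrightarrow> S' \<in> P \<Longrightarrow> S \<noteq> S' \<Longrightarrow> card (S \<inter> H \<inter> (S' \<inter> H)) \<le> ?q"
    and hyp: "\<And>S S'. S \<in> P \<Longrightarrow> S' \<in> P \<Longrightarrow> S \<noteq> S' \<Longrightarrow> card (S \<inter> H \<inter> (S' \<inter> H)) = ?q \<Longrightarrow>
        nondeg_quadric (r + 2) Q (lspan (r + 2) (S \<union> S') \<inter> H) (r + 1 - e) 0"
    using av unfolding generator_def dims by auto
  have lH: "is_lsub (vecs (r + 2)) H" using sH by (simp add: is_sub_def)
  have lS: "is_lsub (vecs (r + 2)) S" if "S \<in> P" for S using sS[OF that] by (simp add: is_sub_def)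
  have SV: "v \<in> vecs (r + 2)" if "S \<in> P" "v \<in> S" for S v using lsub_subset[OF lS] that by blast
  have ns: "nonsingular_on Q H" using nd by (simp add: nondeg_quadric_def)
  have c: "c \<noteq> 0" and lin: "linear_on H f" and im: "\<And>h. h \<in> H \<Longrightarrow> f h \<in> W0"
    and Qf: "\<And>h. h \<in> H \<Longrightarrow> Q2 (f h) = c * Q h"
    using sim by (auto simp: similitude_def)
  have inj: "inj_on f H" using similitude_inj[OF Q Q2 lH ns sim] .
  have fV: "f h \<in> vecs (r + 3)" and xf: "polar Q2 x (f h) = 0" and yf: "polar Q2 y (f h) = 0"
    if "h \<in> H" for h
    using im[OF that] by (auto simp: W0)
  have yx: "polar Q2 y x = 1" using xy Q2.polar_commute by metis
  have xx: "polar Q2 x x = 0" "polar Q2 y y = 0" using xy by (auto simp: Q2.polar_self)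
  \<comment> \<open>Pairing with \<open>x\<close> isolates \<open>b\<close>, pairing with
    \<open>y\<close> isolates \<open>a\<close>, and injectivity of \<open>f\<close> gives the
    rest.\<close>
  have coords: "a = a' \<and> b = b' \<and> g = g'"
    if g: "g \<in> H" "g' \<in> H" and eq: "a *s x + b *s y + f g = a' *s x + b' *s y + f g'" for a b a' b' g g'
  proof -
    have "b = b'"
      using arg_cong[OF eq, of "polar Q2 x"] xf[OF g(1)] xf[OF g(2)] xy xx by (simp add: Q2.bilin)
    moreover have "a = a'"
      using arg_cong[OF eq, of "polar Q2 y"] yf[OF g(1)] yf[OF g(2)] yx xx by (simp add: Q2.bilin)
    ultimately show ?thesis using eq inj g by (auto simp: inj_on_def)
  qed
  have Q2_coords: "Q2 (a *s x + b *s y + f g) = a * b + c * Q g" if "g \<in> H" for a b g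
    using Qf[OF that] xf[OF that] yf[OF that] xy by (simp add: Q2.bilin)

  have q0: "?q > 0" using card_field_ge_2[where 'a='a] by simp
  have finP: "finite P" using cP q0 by (intro card_ge_0_finite) simp
  have "P \<noteq> {}" using cP q0 by auto
  then obtain p0 where p0: "p0 \<in> vecs (r + 2)" "p0 \<notin> H" using SH SV by blast
  have eqV: "line_plus p0 H = vecs (r + 2)"
    using is_sub_line_plus[OF sH p0] is_sub_vecs[of "r + 2", where 'a='a]
      line_plus_subset[OF lsub_vecs p0(1) lsub_subset[OF lH]]
    by (intro is_sub_eqI[of "r + 2" _ "r + 2"]) auto
  have "\<exists>a g. g \<in> H \<and> v = a *s p0 + g" if "v \<in> vecs (r + 2)" for v
    using that line_plus_iff[of v p0 H] unfolding eqV by metis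
  \<comment> \<open>On \<open>vecs (r + 2)\<close>, \<open>l\<close> is the linear functional with
    kernel \<open>H\<close> and \<open>l p0 = 1\<close>, and \<open>h\<close> is the projection to
    \<open>H\<close> along \<open>p0\<close>. Both are linear because the decomposition is
    unique.\<close>
  then obtain l h where hH: "\<And>v. v \<in> vecs (r + 2) \<Longrightarrow> h v \<in> H"
    and lh: "\<And>v. v \<in> vecs (r + 2) \<Longrightarrow> v = l v *s p0 + h v"
    by metis
  have lh_unique: "l v = a \<and> h v = g" if "v = a *s p0 + g" "g \<in> H" for v a g
  proof -
    have "v \<in> vecs (r + 2)" using that unfolding eqV[symmetric] line_plus_iff by blast
    then show ?thesis using line_plus_unique[OF lH p0(2) hH that(2)] lh that(1) by metis
  qed
  have lh_add: "l (u + v) = l u + l v \<and> h (u + v) = h u + h v"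
    if "u \<in> vecs (r + 2)" "v \<in> vecs (r + 2)" for u v
  proof (rule lh_unique)
    have "u + v = (l u *s p0 + h u) + (l v *s p0 + h v)" using that lh by metis
    then show "u + v = (l u + l v) *s p0 + (h u + h v)" by (simp add: smul_distribs)
    show "h u + h v \<in> H" using that hH by (intro lsub_add[OF lH])
  qed
  have lh_smul: "l (a *s v) = a * l v \<and> h (a *s v) = a *s h v" if "v \<in> vecs (r + 2)" for a v
  proof (rule lh_unique)
    have "a *s v = a *s (l v *s p0 + h v)" using that lh by metis
    then show "a *s v = (a * l v) *s p0 + a *s h v" by (simp add: smul_distribs)
    show "a *s h v \<in> H" using that hH by (intro lsub_smul[OF lH])
  qed
  have lh_H: "l v = 0 \<and> h v = v" if "v \<in> H" for v using that by (intro lh_unique) auto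
  have l0: "v \<in> H \<and> h v = v" if "v \<in> vecs (r + 2)" "l v = 0" for v
    using lh[OF that(1)] hH[OF that(1)] that(2) by simp
  have "\<exists>s\<in>S. l s = 1" if S: "S \<in> P" for S
  proof -
    obtain v where v: "v \<in> S" "v \<notin> H" using SH[OF S] by blast
    then have "l v \<noteq> 0" using l0 SV[OF S] by blast
    then have "l (inverse (l v) *s v) = 1" using lh_smul[OF SV[OF S v(1)]] by simp
    then show ?thesis using lsub_smul[OF lS[OF S] v(1)] by blast
  qed
  then obtain s where sS': "\<And>S. S \<in> P \<Longrightarrow> s S \<in> S" and ls: "\<And>S. S \<in> P \<Longrightarrow> l (s S) = 1" by metis
  \<comment> \<open>\<open>h0 S\<close> serves as base point: \<open>h\<close> maps the vectors of
    \<open>S\<close> with \<open>l v = 1\<close> onto the coset of \<open>S \<inter> H\<close>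
    through \<open>h0 S\<close>.\<close>
  define h0 where "h0 S = h (s S)" for S
  have h0H: "h0 S \<in> H" if "S \<in> P" for S using hH SV sS' that by (auto simp: h0_def)
  have decomp: "\<exists>g\<in>S \<inter> H. h v = l v *s h0 S + g" if S: "S \<in> P" and v: "v \<in> S" for S v
  proof -
    define g where "g = v - l v *s s S"
    have gS: "g \<in> S" unfolding g_def by (intro lsub_closed[OF lS[OF S]] v sS' S)
    have vg: "v = l v *s s S + g" by (simp add: g_def)
    have sV: "l v *s s S \<in> vecs (r + 2)" by (intro lsub_smul[OF lsub_vecs] SV[OF S] sS' S)
    note gV = SV[OF S gS]
    have "l v = l v + l g" "h v = l v *s h0 S + h g"
      using lh_add[OF sV gV] lh_smul[OF SV[OF S sS'[OF S]], of "l v"] ls[OF S]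
      unfolding vg[symmetric] h0_def by auto
    then show ?thesis using l0[OF gV] gS by auto
  qed

  \<comment> \<open>On the affine part \<open>l v = 1\<close> of \<open>S\<close> the first coordinate is \<open>- c * Q (h v)\<close>.\<close>
  define L where "L S v = (- c * (polar Q (h0 S) (h v) - l v * Q (h0 S))) *s x + l v *s y + f (h v)" for S v
  \<comment> \<open>With \<open>h v = l v *s h0 S + g\<close> and \<open>Q g = 0\<close>, the
    bracket equals \<open>l v * Q (h0 S) + polar Q (h0 S) g\<close>. As written it is visibly linear
    in \<open>v\<close>, which makes \<open>L S\<close> linear although \<open>Q\<close> is
    quadratic.\<close>
  have Q_h: "Q (h v) = l v * (polar Q (h0 S) (h v) - l v * Q (h0 S))" if S: "S \<in> P" and v: "v \<in> S" for S v
  proof -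
    obtain g where g: "g \<in> S \<inter> H" "h v = l v *s h0 S + g" using decomp[OF S v] by blast
    have "Q g = 0" using gS[OF S] g by (auto simp: tsing_def)
    then show ?thesis unfolding g(2)
      by (simp add: Q.bilin Q.polar_self Q.polar_commute[of g] algebra_simps power2_eq_square)
  qed
  have QL: "Q2 (L S v) = 0" if S: "S \<in> P" and v: "v \<in> S" for S v
    unfolding L_def Q2_coords[OF hH[OF SV[OF S v]]] Q_h[OF S v] by (simp add: algebra_simps)
  have linL: "linear_on S (L S)" if S: "S \<in> P" for S
    unfolding linear_on_def L_def
    using lh_add lh_smul SV[OF S] hH
    by (auto simp: linear_on_add[OF lin] linear_on_smul[OF lin] Q.bilin smul_distribs algebra_simps)
  \<comment> \<open>The \<open>y\<close> and \<open>W0\<close> coordinates determine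
    \<open>l v\<close> and \<open>h v\<close>, hence \<open>v\<close>. Images under
    \<open>L S\<close> and \<open>L S'\<close> thus meet only over a common vector, and the
    \<open>x\<close> coordinates compare the two brackets.\<close>
  have L_eq: "v = v' \<and> polar Q (h0 S) (h v) - l v * Q (h0 S) = polar Q (h0 S') (h v') - l v' * Q (h0 S')"
    if "v \<in> vecs (r + 2)" "v' \<in> vecs (r + 2)" "L S v = L S' v'" for S S' v v'
    using coords[OF hH[OF that(1)] hH[OF that(2)] that(3)[unfolded L_def]] lh[OF that(1)] lh[OF that(2)] c
    by auto
  have injL: "inj_on (L S) S" if S: "S \<in> P" for S
    using L_eq SV[OF S] by (auto simp: inj_on_def)
  have gL: "tsing (r + 3) Q2 (vecs (r + 3)) (L S ` S) (Suc k)" if S: "S \<in> P" for S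
  proof -
    have "L S ` S \<subseteq> vecs (r + 3)"
      using SV[OF S] hH fV xy by (auto simp: L_def intro!: lsub_add[OF lsub_vecs] lsub_diff[OF lsub_vecs] lsub_smul[OF lsub_vecs])
    then show ?thesis
      using is_sub_image[OF linL[OF S] injL[OF S] sS[OF S]] QL[OF S] by (auto simp: tsing_def)
  qed

  have zero_tsing: "0 \<in> A" if "tsing (r + 3) Q2 (vecs (r + 3)) A (Suc k)" for A
    using that unfolding tsing_def is_sub_def by (blast intro: lsub_zero)
  have disj: "L S ` S \<inter> L S' ` S' = {0}" if S: "S \<in> P" "S' \<in> P" "S \<noteq> S'" for S S'
  proof (rule equalityI)
    show "{0} \<subseteq> L S ` S \<inter> L S' ` S'" using zero_tsing[OF gL] S by blast
    show "L S ` S \<inter> L S' ` S' \<subseteq> {0}"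
    proof
      fix w assume "w \<in> L S ` S \<inter> L S' ` S'"
      then obtain v v' where v: "v \<in> S" "w = L S v" and v': "v' \<in> S'" "w = L S' v'" by blast
      have vV: "v \<in> vecs (r + 2)" "v' \<in> vecs (r + 2)" using SV v v' S by blast+
      have eq: "L S v = L S' v'" using v v' by simp
      have vv: "v' = v" using L_eq[OF vV eq] by simp
      have vS': "v \<in> S'" using v' vv by simp
      have lines: "line_plus v {0} \<subseteq> T" if "T \<in> P" "v \<in> T" for T
        using line_plus_subset[OF lS[OF that(1)] that(2)] lsub_zero[OF lS[OF that(1)]] by auto
      have vline: "v \<in> line_plus v {0}"
        unfolding line_plus_iff by (rule exI[of _ 1]) simp
      \<comment> \<open>Outside \<open>H\<close>, \<open>v\<close> would span a point lying in two
        members of the partition.\<close>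
      have vH: "v \<in> H"
      proof (rule ccontr)
        assume "v \<notin> H"
        then have "is_sub (r + 2) (line_plus v {0}) 1" "\<not> line_plus v {0} \<subseteq> H"
          using is_sub_line[OF vV(1)] lsub_zero[OF lH] vline by auto
        from part[OF this] show False using lines[OF S(1) v(1)] lines[OF S(2) vS'] S by blast
      qed
      have "v = 0"
      proof (rule ccontr)
        assume nz: "v \<noteq> 0"
        have hv: "h v = v" "l v = 0" using lh_H[OF vH] by auto
        \<comment> \<open>At \<open>l v = 0\<close> the equality of \<open>x\<close> coordinates
          says that both base points pair equally with \<open>v\<close>.\<close>
        have pol: "polar Q (h0 S) v = polar Q (h0 S') v"
          using L_eq[OF vV eq] vv hv by simp
        \<comment> \<open>The multiples of \<open>v\<close> are q common vectors and condition (2)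
          allows no more, so condition (3) applies.\<close>
        have "line_plus v {0} \<subseteq> S \<inter> H \<inter> (S' \<inter> H)"
          using lines[OF S(1) v(1)] lines[OF S(2) vS'] line_plus_subset[OF lH vH, of "{0}"] lsub_zero[OF lH]
          by auto
        moreover have "finite (S \<inter> H \<inter> (S' \<inter> H))" using is_sub_finite[OF sH] by blast
        ultimately have "card (line_plus v {0}) \<le> card (S \<inter> H \<inter> (S' \<inter> H))" by (rule card_mono[rotated])
        moreover have "card (line_plus v {0}) = ?q"
          using is_sub_line[OF vV(1) nz] by (simp add: is_sub_def)
        ultimately have "card (S \<inter> H \<inter> (S' \<inter> H)) = ?q" using small[OF S] by simp
        from hyp[OF S this] have nsS: "nonsingular_on Q (lspan (r + 2) (S \<union> S') \<inter> H)"
          by (simp add: nondeg_quadric_def)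
        \<comment> \<open>A subspace chosen to contain \<open>S\<close> and \<open>S'\<close>, hence
          their span. On \<open>H\<close>, where \<open>l\<close> vanishes, membership in
          \<open>T\<close> means orthogonality to \<open>v\<close>.\<close>
        define T where "T = {u\<in>vecs (r + 2). polar Q v (h u) = l u * polar Q v (h0 S)}"
        have lT: "is_lsub (vecs (r + 2)) T"
          unfolding is_lsub_iff T_def
          using lh_add lh_smul lsub_closed[OF lsub_vecs] lh_H[OF lsub_zero[OF lH]]
          by (auto simp: Q.bilin algebra_simps)
        \<comment> \<open>Applied to both \<open>S\<close> and \<open>S'\<close>. The totally
          singular \<open>R \<inter> H\<close> contains \<open>v\<close>, so only the base point
          contributes to the pairing.\<close>
        have RT: "R \<subseteq> T" if R: "R \<in> P" "v \<in> R" "polar Q (h0 R) v = polar Q (h0 S) v" for R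
        proof
          fix u assume u: "u \<in> R"
          obtain g where g: "g \<in> R \<inter> H" "h u = l u *s h0 R + g" using decomp[OF R(1) u] by blast
          have "polar Q v g = 0"
            using Q.polar_singular[of "vecs (r + 2)" "R \<inter> H" v g] gS[OF R(1)] R(2) vH g(1)
            by (auto simp: tsing_def is_sub_def)
          then have "polar Q v (h u) = l u * polar Q v (h0 S)"
            unfolding g(2) using R(3) by (simp add: Q.bilin Q.polar_commute[of v])
          then show "u \<in> T" using SV[OF R(1) u] by (simp add: T_def)
        qed
        have "S \<union> S' \<subseteq> T" using RT[OF S(1) v(1) refl] RT[OF S(2) vS' pol[symmetric]] by (rule Un_least)
        with lT have span: "lspan (r + 2) (S \<union> S') \<subseteq> T" unfolding lspan_def by blast
        have "polar Q v u = 0" if "u \<in> lspan (r + 2) (S \<union> S') \<inter> H" for u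
          using that span lh_H[of u] by (auto simp: T_def)
        moreover have "v \<in> lspan (r + 2) (S \<union> S') \<inter> H" using v(1) vH by (auto simp: lspan_def)
        moreover have "Q v = 0" using gS[OF S(1)] v(1) vH by (auto simp: tsing_def)
        ultimately show False using nsS nz unfolding nonsingular_on_def fun_ops_eq by blast
      qed
      then show "w \<in> {0}"
        using v linear_on_zero[OF linL[OF S(1)] lsub_zero[OF lS[OF S(1)]]] by simp
    qed
  qed

  have lPi: "is_lsub (vecs (r + 2)) Pi" and PiH: "Pi \<subseteq> H" and QPi: "\<forall>g\<in>Pi. Q g = 0"
    and sPi: "is_sub (r + 2) Pi k"
    using gPi by (auto simp: tsing_def is_sub_def)
  \<comment> \<open>The spread element through the projection centre \<open>x\<close>.\<close>
  define E where "E = line_plus x (f ` Pi)"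
  have gE: "tsing (r + 3) Q2 (vecs (r + 3)) E (Suc k)"
    unfolding E_def
  proof (rule Q2.tsing_line_plus[OF _ lsub_vecs xy(1) _ xy(3)])
    have "linear_on Pi f" using lin PiH unfolding linear_on_def by (meson subsetD)
    moreover have "inj_on f Pi" using inj PiH by (rule inj_on_subset)
    ultimately have "is_sub (r + 3) (f ` Pi) k" using PiH fV by (intro is_sub_image[OF _ _ sPi]) auto
    then show "tsing (r + 3) Q2 (vecs (r + 3)) (f ` Pi) k"
      using PiH fV Qf QPi by (auto simp: tsing_def)
    have "polar Q2 y g = 0" if "g \<in> f ` Pi" for g using that yf PiH by auto
    then show "x \<notin> f ` Pi" using yx by (metis zero_neq_one)
    show "\<forall>g\<in>f ` Pi. polar Q2 x g = 0" using xf PiH by auto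
  qed
  have disjE: "E \<inter> L S ` S = {0}" if S: "S \<in> P" for S
  proof (rule equalityI)
    show "{0} \<subseteq> E \<inter> L S ` S"
      using zero_tsing[OF gE] zero_tsing[OF gL[OF S]] by blast
    show "E \<inter> L S ` S \<subseteq> {0}"
    proof
      fix w assume "w \<in> E \<inter> L S ` S"
      then obtain a g v where g: "g \<in> Pi" "w = a *s x + f g" and v: "v \<in> S" "w = L S v"
        by (auto simp: E_def line_plus_iff)
      have eq: "a *s x + 0 *s y + f g =
        (- c * (polar Q (h0 S) (h v) - l v * Q (h0 S))) *s x + l v *s y + f (h v)"
        using g v by (simp add: L_def)
      \<comment> \<open>Vectors of \<open>E\<close> have \<open>y\<close> coordinate zero, so a
        common vector comes from \<open>S \<inter> H \<inter> Pi\<close>, which is trivial by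
        condition (1).\<close>
      have "l v = 0" "h v = g"
        using coords[OF _ hH[OF SV[OF S v(1)]] eq] g(1) PiH by auto
      then have "v \<in> S \<inter> H \<inter> Pi" using l0[OF SV[OF S v(1)]] v(1) g(1) by auto
      then have "v = 0" using SPi[OF S] by blast
      then show "w \<in> {0}"
        using v linear_on_zero[OF linL[OF S] lsub_zero[OF lS[OF S]]] by simp
    qed
  qed
  \<comment> \<open>As \<open>Suc k\<close> is positive, trivially intersecting members are
    distinct, which makes the size of the spread exactly \<open>card P + 1\<close>.\<close>
  have nontriv: "A \<noteq> {0}" if A: "tsing (r + 3) Q2 (vecs (r + 3)) A (Suc k)" for A
    using is_sub_nontrivial[of "r + 3" A k] A unfolding tsing_def by blast
  define Sg where "Sg = insert E ((\<lambda>S. L S ` S) ` P)"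
  have "inj_on (\<lambda>S. L S ` S) P"
  proof (rule inj_onI, rule ccontr)
    fix S S' assume "S \<in> P" "S' \<in> P" "L S ` S = L S' ` S'" "S \<noteq> S'"
    then show False using disj[of S S'] nontriv[OF gL[of S]] by simp
  qed
  moreover have "E \<notin> (\<lambda>S. L S ` S) ` P"
  proof
    assume "E \<in> (\<lambda>S. L S ` S) ` P"
    then obtain S where "S \<in> P" "E = L S ` S" by blast
    then show False using disjE[of S] nontriv[OF gE] by simp
  qed
  ultimately have "card Sg = ?q ^ ((r + e + 1) div 2) + 1"
    using finP cP by (simp add: Sg_def card_image)
  moreover have "A \<inter> B = {0}"
    if AB: "A \<in> Sg" "B \<in> Sg" "A \<noteq> B" for A B
  proof -
    consider "A = E" "B = E" | S where "A = E" "S \<in> P" "B = L S ` S"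
      | S where "B = E" "S \<in> P" "A = L S ` S"
      | S S' where "S \<in> P" "A = L S ` S" "S' \<in> P" "B = L S' ` S'"
      using AB(1,2) unfolding Sg_def by blast
    then show ?thesis
    proof cases
      case 1 with AB show ?thesis by simp
    next
      case 2 then show ?thesis using disjE by simp
    next
      case 3 then show ?thesis using disjE by (simp add: Int_commute)
    next
      case (4 S S')
      then show ?thesis using disj[of S S'] AB(3) by (cases "S = S'") simp_all
    qed
  qed
  moreover have "\<forall>A\<in>Sg. tsing (r + 3) Q2 (vecs (r + 3)) A (Suc k)"
    using gE gL unfolding Sg_def by blast
  ultimately have "is_spread (r + 3) Q2 (vecs (r + 3)) (r + 3) e Sg"
    unfolding is_spread_def generator_def dims fun_ops_eq by blast
  then show ?thesis by blast
qed

theorem mainTheorem1: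
  fixes r e :: nat
  assumes "e \<in> {0, 1, 2}"
    and "e \<in> {0, 2} \<longrightarrow> odd r"
    and "e = 1 \<longrightarrow> even r"
    and "\<exists>(H :: (nat \<Rightarrow> 'a::{field,finite}) set) Q Pi P. special_avsp r e H Q Pi P"
  shows "\<forall>Q :: (nat \<Rightarrow> 'a) \<Rightarrow> 'a.
           quad_form (r + 3) Q \<and> nondeg_quadric (r + 3) Q (vecs (r + 3)) (r + 3) e \<longrightarrow>
           (\<exists>\<Sigma>. is_spread (r + 3) Q (vecs (r + 3)) (r + 3) e \<Sigma>)"
proof (intro allI impI)
  fix Q2 :: "(nat \<Rightarrow> 'a) \<Rightarrow> 'a"
  assume "quad_form (r + 3) Q2 \<and> nondeg_quadric (r + 3) Q2 (vecs (r + 3)) (r + 3) e"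
  then have qf2: "quad_form (r + 3) Q2" and nd2: "nondeg_quadric (r + 3) Q2 (vecs (r + 3)) (r + 3) e"
    by auto
  obtain H Q Pi P where avsp: "special_avsp r e (H :: (nat \<Rightarrow> 'a) set) Q Pi P"
    using assms(4) by blast
  then have qf: "quad_form (r + 2) Q" and nd: "nondeg_quadric (r + 2) Q H (r + 1) e"
    by (auto simp: special_avsp_def)
  obtain k where k: "r + 1 = 2 * k + e"
  proof -
    have "even (r + 1 + e)" using assms(1-3) by auto
    \<comment> \<open>The parity conditions allow \<open>r = 0\<close> only for
      \<open>e = 1\<close>, so the natural subtraction \<open>r + 1 - e\<close> is exact.\<close>
    moreover have "e \<le> r + 1" using assms(1-3) by (cases "r = 0") auto
    ultimately have "r + 1 = 2 * ((r + 1 - e) div 2) + e" by (simp add: even_add)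
    then show thesis using that by blast
  qed
  then have k2: "r + 3 = 2 * Suc k + e" by simp
  have Q: "quadratic Q" and Q2: "quadratic Q2"
    using quadratic_if_quad_form[OF qf] quadratic_if_quad_form[OF qf2] by auto
  interpret Q2: quadratic Q2 by fact
  \<comment> \<open>One split of the ambient space leaves a quadric with the dimension and type of
    the one in \<open>H\<close>, as the similitude requires.\<close>
  obtain x y where xy: "x \<in> vecs (r + 3)" "y \<in> vecs (r + 3)" "Q2 x = 0" "Q2 y = 0" "polar Q2 x y = 1"
    and nd0: "nondeg_quadric (r + 3) Q2 {w\<in>vecs (r + 3). polar Q2 x w = 0 \<and> polar Q2 y w = 0} (2 * k + e) e"
    unfolding k2 by (rule Q2.hyperbolic_split[OF nd2[unfolded k2]])
  have "e \<le> 2" using assms(1) by auto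
  then obtain c f where
    "similitude Q H Q2 {w\<in>vecs (r + 3). polar Q2 x w = 0 \<and> polar Q2 y w = 0} c f"
    using similitude_exists[OF Q Q2 _ nd[unfolded k] nd0] by blast
  then show "\<exists>\<Sigma>. is_spread (r + 3) Q2 (vecs (r + 3)) (r + 3) e \<Sigma>"
    using spread_from_avsp[OF Q Q2 avsp k xy refl] by blast
qed

end
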